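(* Let $X$ be a Banach lattice having the lattice-lifting property. Then: (i) $Hom(X,\mathbb{R})$ separates the points of $X$; (ii) $X$ satisfies the $\sigma$-bounded chain condition.
   Context: All Banach spaces are real; $B_E$ is the closed unit ball of $E$. A lattice homomorphism between Banach lattices is a bounded linear operator preserving lattice operations; $Hom(X,\mathbb{R})\subseteq X^*$ is the set of all lattice homomorphisms from $X$ to $\mathbb{R}$. A sublattice means a closed vector sublattice. $X_+=\{x\in X:x\ge0\}$. A Banach lattice $X$ satisfies the $\sigma$-bounded chain condition if $X_+\setminus\{0\}$ can be written as a countable union $X_+\setminus\{0\}=\bigcup_{n\ge2}\mathcal{F}_n$ such that, for each $n\ge2$ and each $\mathcal{G}\subseteq\mathcal{F}_n$ with cardinality $n$, there exist distinct $x,y\in\mathcal{G}$ with $x\wedge y\ne0$. Free Banach lattice: for a Banach space $E$ and a positively homogeneous function $f:E^*\to\mathbb{R}$ (i.e. $f(\lambda x^* )=\lambda f(x^* )$ for $\lambda>0$), put $\|f\|_{FBL[E]}:=\sup\{\sum_{i=1}^n|f(x_i^* )|: n\in\mathbb{N},\ x_1^*,\dots,x_n^*\in E^*,\ \sup_{x\in B_E}\sum_{i=1}^n|x_i^*(x)|\le 1\}\in[0,\infty]$. Let $H_0[E]$ be the Banach lattice of all positively homogeneous $f$ with $\|f\|_{FBL[E]}<\infty$, with this norm and the pointwise order. $FBL[E]$ is the (closed) sublattice of $H_0[E]$ generated by $\{\delta_E(x):x\in E\}$, where $\delta_E(x)(x^* ):=x^*(x)$. The map $\delta_E:E\to FBL[E]$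 is a linear isometry, and for every Banach lattice $X$ and bounded linear $T:E\to X$ there is a unique lattice homomorphism $\hat T:FBL[E]\to X$ with $\hat T\circ\delta_E=T$; moreover $\|\hat T\|=\|T\|$. For a Banach lattice $X$, $\beta_X:FBL[X]\to X$ is the unique lattice homomorphism with $\beta_X\circ\delta_X=id_X$. A Banach lattice $X$ has the lattice-lifting property if there is a lattice homomorphism $T:X\to FBL[X]$ with $\beta_X\circ T=id_X$. *)

theory Defs
  imports "HOL-Analysis.Analysis" "HOL-Library.Lattice_Algebras"
begin

section \<open>Banach lattices\<close>

text \<open>The class \<open>lattice_ab_group_add_abs\<close> contributes the compatible lattice structure and
  \<open>\<bar>x\<bar> = sup x (- x)\<close>.\<close>

class banach_lattice = banach + ordered_real_vector + lattice_ab_group_add_abs +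
  assumes norm_abs_mono: "\<bar>x\<bar> \<le> \<bar>y\<bar> \<Longrightarrow> norm x \<le> norm y"

instance real :: banach_lattice
  by standard simp

definition lattice_hom :: "('a::banach_lattice \<Rightarrow> 'b::banach_lattice) \<Rightarrow> bool" where
  "lattice_hom T \<longleftrightarrow> bounded_linear T \<and>
     (\<forall>x y. T (sup x y) = sup (T x) (T y)) \<and> (\<forall>x y. T (inf x y) = inf (T x) (T y))"

definition Hom_real :: "('a::banach_lattice \<Rightarrow>\<^sub>L real) set" where
  "Hom_real = {\<phi>. lattice_hom (blinfun_apply \<phi>)}"

definition separates_points :: "('a::banach_lattice \<Rightarrow>\<^sub>L real) set \<Rightarrow> bool" where
  "separates_points H \<longleftrightarrow> (\<forall>x y. x \<noteq> y \<longrightarrow> (\<exists>\<phi>\<in>H. blinfun_apply \<phi> x \<noteq> blinfun_apply \<phi> y))"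

definition closed_sublattice :: "'a::banach_lattice set \<Rightarrow> bool" where
  "closed_sublattice S \<longleftrightarrow> closed S \<and> subspace S \<and>
     (\<forall>x\<in>S. \<forall>y\<in>S. sup x y \<in> S \<and> inf x y \<in> S)"

definition generated_sublattice :: "'a::banach_lattice set \<Rightarrow> 'a set" where
  "generated_sublattice A = \<Inter>{S. closed_sublattice S \<and> A \<subseteq> S}"

definition sigma_bounded_chain_condition :: "'a::banach_lattice itself \<Rightarrow> bool" where
  "sigma_bounded_chain_condition _ \<longleftrightarrow>
     (\<exists>F :: nat \<Rightarrow> 'a set. {x. 0 \<le> x} - {0} = (\<Union>n\<in>{2..}. F n) \<and>
        (\<forall>n\<ge>2. \<forall>G\<subseteq>F n. card G = n \<longrightarrow> (\<exists>x\<in>G. \<exists>y\<in>G. x \<noteq> y \<and> inf x y \<noteq> 0)))"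

lemma closed_sublattice_generated: "closed_sublattice (generated_sublattice A)"
proof -
  have "closed (generated_sublattice A)"
    unfolding generated_sublattice_def by (rule closed_Inter) (auto simp: closed_sublattice_def)
  moreover have "subspace (generated_sublattice A)"
    unfolding generated_sublattice_def by (rule subspace_Inter) (auto simp: closed_sublattice_def)
  ultimately show ?thesis
    unfolding closed_sublattice_def by (auto simp: generated_sublattice_def closed_sublattice_def)
qed

lemma generated_sublattice_superset: "A \<subseteq> generated_sublattice A"
  by (auto simp: generated_sublattice_def)


section \<open>The Banach lattice \<open>H\<^sub>0[E]\<close>\<close>

definition pos_homogeneous :: "(('a::banach \<Rightarrow>\<^sub>L real) \<Rightarrow> real) \<Rightarrow> bool" where
  "pos_homogeneous f \<longleftrightarrow> (\<forall>c>0. \<forall>\<phi>. f (c *\<^sub>R \<phi>) = c * f \<phi>)"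

text \<open>Lists represent finite families of functionals, repetitions allowed. Admissibility says that
  \<open>sup\<close> over the unit ball of \<open>\<Sum>\<bar>\<phi>\<^sub>i x\<bar>\<close> is at most 1; the empty family contributes 0 to the norm.\<close>

definition admissible :: "('a::banach \<Rightarrow>\<^sub>L real) list \<Rightarrow> bool" where
  "admissible \<phi>s \<longleftrightarrow> (\<forall>x\<in>cball 0 1. (\<Sum>\<phi>\<leftarrow>\<phi>s. \<bar>blinfun_apply \<phi> x\<bar>) \<le> 1)"

definition FBL_norm :: "(('a::banach \<Rightarrow>\<^sub>L real) \<Rightarrow> real) \<Rightarrow> ennreal" where
  "FBL_norm f = (SUP \<phi>s\<in>{\<phi>s. admissible \<phi>s}. ennreal (\<Sum>\<phi>\<leftarrow>\<phi>s. \<bar>f \<phi>\<bar>))"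

lemma admissible_Nil: "admissible []"
  by (simp add: admissible_def)

lemma sum_list_abs_nonneg: "0 \<le> (\<Sum>\<phi>\<leftarrow>\<phi>s. \<bar>f \<phi>\<bar> :: real)"
  by (rule sum_list_nonneg) auto

lemma FBL_norm_le_iff:
  assumes "0 \<le> c"
  shows "FBL_norm f \<le> ennreal c \<longleftrightarrow> (\<forall>\<phi>s. admissible \<phi>s \<longrightarrow> (\<Sum>\<phi>\<leftarrow>\<phi>s. \<bar>f \<phi>\<bar>) \<le> c)"
  using assms by (auto simp: FBL_norm_def SUP_le_iff)

lemma FBL_norm_finite_iff:
  "FBL_norm f < \<infinity> \<longleftrightarrow> (\<exists>c. \<forall>\<phi>s. admissible \<phi>s \<longrightarrow> (\<Sum>\<phi>\<leftarrow>\<phi>s. \<bar>f \<phi>\<bar>) \<le> c)"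
proof
  assume "FBL_norm f < \<infinity>"
  then obtain c where "0 \<le> c" "FBL_norm f = ennreal c"
    by (cases "FBL_norm f") auto
  then show "\<exists>c. \<forall>\<phi>s. admissible \<phi>s \<longrightarrow> (\<Sum>\<phi>\<leftarrow>\<phi>s. \<bar>f \<phi>\<bar>) \<le> c"
    using FBL_norm_le_iff[of c f] by auto
next
  assume "\<exists>c. \<forall>\<phi>s. admissible \<phi>s \<longrightarrow> (\<Sum>\<phi>\<leftarrow>\<phi>s. \<bar>f \<phi>\<bar>) \<le> c"
  then obtain c where c: "\<And>\<phi>s. admissible \<phi>s \<Longrightarrow> (\<Sum>\<phi>\<leftarrow>\<phi>s. \<bar>f \<phi>\<bar>) \<le> c"
    by blast
  from c[OF admissible_Nil] have "0 \<le> c" by simp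
  then have "FBL_norm f \<le> ennreal c"
    using c FBL_norm_le_iff by blast
  then show "FBL_norm f < \<infinity>"
    using le_less_trans by fastforce
qed

typedef (overloaded) 'a H0 =
  "{f :: ('a::banach \<Rightarrow>\<^sub>L real) \<Rightarrow> real. pos_homogeneous f \<and> FBL_norm f < \<infinity>}"
  morphisms H0_apply Abs_H0
  by (rule exI[of _ "\<lambda>_. 0"])
     (auto simp: pos_homogeneous_def FBL_norm_finite_iff simp del: infinity_ennreal_def)

setup_lifting type_definition_H0

lemma FBL_norm_finite_dominated:
  assumes "FBL_norm f < \<infinity>" "FBL_norm g < \<infinity>" "\<And>\<phi>. \<bar>h \<phi>\<bar> \<le> a * \<bar>f \<phi>\<bar> + b * \<bar>g \<phi>\<bar>"
    and "0 \<le> a" "0 \<le> b"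
  shows "FBL_norm h < \<infinity>"
proof -
  obtain c d where c: "\<And>\<phi>s. admissible \<phi>s \<Longrightarrow> (\<Sum>\<phi>\<leftarrow>\<phi>s. \<bar>f \<phi>\<bar>) \<le> c"
    and d: "\<And>\<phi>s. admissible \<phi>s \<Longrightarrow> (\<Sum>\<phi>\<leftarrow>\<phi>s. \<bar>g \<phi>\<bar>) \<le> d"
    using assms(1,2) unfolding FBL_norm_finite_iff by metis
  have "(\<Sum>\<phi>\<leftarrow>\<phi>s. \<bar>h \<phi>\<bar>) \<le> a * c + b * d" if "admissible \<phi>s" for \<phi>s
  proof -
    have "(\<Sum>\<phi>\<leftarrow>\<phi>s. \<bar>h \<phi>\<bar>) \<le> (\<Sum>\<phi>\<leftarrow>\<phi>s. a * \<bar>f \<phi>\<bar> + b * \<bar>g \<phi>\<bar>)"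
      by (rule sum_list_mono) (rule assms)
    also have "\<dots> = a * (\<Sum>\<phi>\<leftarrow>\<phi>s. \<bar>f \<phi>\<bar>) + b * (\<Sum>\<phi>\<leftarrow>\<phi>s. \<bar>g \<phi>\<bar>)"
      by (simp add: sum_list_addf sum_list_const_mult)
    also have "\<dots> \<le> a * c + b * d"
      using c[OF that] d[OF that] assms by (intro add_mono mult_left_mono)
    finally show ?thesis .
  qed
  then show ?thesis
    unfolding FBL_norm_finite_iff by blast
qed

instantiation H0 :: (banach) "{lattice_ab_group_add_abs, real_vector}"
begin

lift_definition zero_H0 :: "'a H0" is "\<lambda>_. 0"
  by (auto simp: pos_homogeneous_def FBL_norm_finite_iff simp del: infinity_ennreal_def)

lift_definition plus_H0 :: "'a H0 \<Rightarrow> 'a H0 \<Rightarrow> 'a H0" is "\<lambda>f g \<phi>. f \<phi> + g \<phi>"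
proof (intro conjI; elim conjE)
  fix f g :: "('a \<Rightarrow>\<^sub>L real) \<Rightarrow> real"
  assume "pos_homogeneous f" "pos_homogeneous g" "FBL_norm f < \<infinity>" "FBL_norm g < \<infinity>"
  then show "pos_homogeneous (\<lambda>\<phi>. f \<phi> + g \<phi>)" "FBL_norm (\<lambda>\<phi>. f \<phi> + g \<phi>) < \<infinity>"
    using FBL_norm_finite_dominated[of f g "\<lambda>\<phi>. f \<phi> + g \<phi>" 1 1]
    by (auto simp: pos_homogeneous_def algebra_simps)
qed

lift_definition minus_H0 :: "'a H0 \<Rightarrow> 'a H0 \<Rightarrow> 'a H0" is "\<lambda>f g \<phi>. f \<phi> - g \<phi>"
proof (intro conjI; elim conjE)
  fix f g :: "('a \<Rightarrow>\<^sub>L real) \<Rightarrow> real"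
  assume "pos_homogeneous f" "pos_homogeneous g" "FBL_norm f < \<infinity>" "FBL_norm g < \<infinity>"
  then show "pos_homogeneous (\<lambda>\<phi>. f \<phi> - g \<phi>)" "FBL_norm (\<lambda>\<phi>. f \<phi> - g \<phi>) < \<infinity>"
    using FBL_norm_finite_dominated[of f g "\<lambda>\<phi>. f \<phi> - g \<phi>" 1 1]
    by (auto simp: pos_homogeneous_def algebra_simps)
qed

lift_definition uminus_H0 :: "'a H0 \<Rightarrow> 'a H0" is "\<lambda>f \<phi>. - f \<phi>"
  by (auto simp: pos_homogeneous_def FBL_norm_def)

lift_definition scaleR_H0 :: "real \<Rightarrow> 'a H0 \<Rightarrow> 'a H0" is "\<lambda>c f \<phi>. c * f \<phi>"
proof (intro conjI; elim conjE)
  fix c and f :: "('a \<Rightarrow>\<^sub>L real) \<Rightarrow> real"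
  assume "pos_homogeneous f" "FBL_norm f < \<infinity>"
  then show "pos_homogeneous (\<lambda>\<phi>. c * f \<phi>)" "FBL_norm (\<lambda>\<phi>. c * f \<phi>) < \<infinity>"
    using FBL_norm_finite_dominated[of f f "\<lambda>\<phi>. c * f \<phi>" "\<bar>c\<bar>" 0]
    by (auto simp: pos_homogeneous_def abs_mult)
qed

lift_definition sup_H0 :: "'a H0 \<Rightarrow> 'a H0 \<Rightarrow> 'a H0" is "\<lambda>f g \<phi>. sup (f \<phi>) (g \<phi>)"
proof (intro conjI; elim conjE)
  fix f g :: "('a \<Rightarrow>\<^sub>L real) \<Rightarrow> real"
  assume "pos_homogeneous f" "pos_homogeneous g" "FBL_norm f < \<infinity>" "FBL_norm g < \<infinity>"
  then show "pos_homogeneous (\<lambda>\<phi>. sup (f \<phi>) (g \<phi>))" "FBL_norm (\<lambda>\<phi>. sup (f \<phi>) (g \<phi>)) < \<infinity>"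
    using FBL_norm_finite_dominated[of f g "\<lambda>\<phi>. sup (f \<phi>) (g \<phi>)" 1 1]
    by (auto simp: pos_homogeneous_def sup_real_def max_mult_distrib_left)
qed

lift_definition inf_H0 :: "'a H0 \<Rightarrow> 'a H0 \<Rightarrow> 'a H0" is "\<lambda>f g \<phi>. inf (f \<phi>) (g \<phi>)"
proof (intro conjI; elim conjE)
  fix f g :: "('a \<Rightarrow>\<^sub>L real) \<Rightarrow> real"
  assume "pos_homogeneous f" "pos_homogeneous g" "FBL_norm f < \<infinity>" "FBL_norm g < \<infinity>"
  then show "pos_homogeneous (\<lambda>\<phi>. inf (f \<phi>) (g \<phi>))" "FBL_norm (\<lambda>\<phi>. inf (f \<phi>) (g \<phi>)) < \<infinity>"
    using FBL_norm_finite_dominated[of f g "\<lambda>\<phi>. inf (f \<phi>) (g \<phi>)" 1 1]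
    by (auto simp: pos_homogeneous_def inf_real_def min_mult_distrib_left)
qed

lift_definition abs_H0 :: "'a H0 \<Rightarrow> 'a H0" is "\<lambda>f \<phi>. \<bar>f \<phi>\<bar>"
  by (auto simp: pos_homogeneous_def FBL_norm_def abs_mult)

lift_definition less_eq_H0 :: "'a H0 \<Rightarrow> 'a H0 \<Rightarrow> bool" is "\<lambda>f g. \<forall>\<phi>. f \<phi> \<le> g \<phi>" .

definition less_H0 :: "'a H0 \<Rightarrow> 'a H0 \<Rightarrow> bool" where
  "less_H0 f g \<longleftrightarrow> f \<le> g \<and> \<not> g \<le> f"

instance
proof
  fix f g h :: "'a H0" and a b :: real
  show "f + g + h = f + (g + h)" "f + g = g + f" "0 + f = f" "- f + f = 0" "f - g = f + - g"
    by (transfer; simp add: algebra_simps)+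
  show "a *\<^sub>R (f + g) = a *\<^sub>R f + a *\<^sub>R g" "(a + b) *\<^sub>R f = a *\<^sub>R f + b *\<^sub>R f"
    "a *\<^sub>R b *\<^sub>R f = (a * b) *\<^sub>R f" "1 *\<^sub>R f = f"
    by (transfer; simp add: algebra_simps)+
  show "f < g \<longleftrightarrow> f \<le> g \<and> \<not> g \<le> f" by (fact less_H0_def)
  show "f \<le> f" by transfer simp
  show "f \<le> g \<Longrightarrow> g \<le> h \<Longrightarrow> f \<le> h" by transfer (meson order_trans)
  show "f \<le> g \<Longrightarrow> g \<le> f \<Longrightarrow> f = g" by transfer (auto intro!: ext antisym)
  show "f \<le> g \<Longrightarrow> h + f \<le> h + g" by transfer simp
  show "inf f g \<le> f" "inf f g \<le> g" "f \<le> sup f g" "g \<le> sup f g" by (transfer; simp)+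
  show "f \<le> g \<Longrightarrow> f \<le> h \<Longrightarrow> f \<le> inf g h" "g \<le> f \<Longrightarrow> h \<le> f \<Longrightarrow> sup g h \<le> f"
    by (transfer; simp)+
  show "\<bar>f\<bar> = sup f (- f)" by transfer (auto simp: sup_real_def)
qed

end

instantiation H0 :: (banach) real_normed_vector
begin

lift_definition norm_H0 :: "'a H0 \<Rightarrow> real" is "\<lambda>f. enn2real (FBL_norm f)" .

definition sgn_H0 :: "'a H0 \<Rightarrow> 'a H0" where
  "sgn_H0 f = f /\<^sub>R norm f"

definition dist_H0 :: "'a H0 \<Rightarrow> 'a H0 \<Rightarrow> real" where
  "dist_H0 f g = norm (f - g)"

definition uniformity_H0 :: "('a H0 \<times> 'a H0) filter" where
  "uniformity_H0 = (INF e\<in>{0 <..}. principal {(x, y). dist x y < e})"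

definition open_H0 :: "'a H0 set \<Rightarrow> bool" where
  "open_H0 U = (\<forall>x\<in>U. eventually (\<lambda>(x', y). x' = x \<longrightarrow> y \<in> U) uniformity)"

lemma norm_H0_le_iff:
  assumes "0 \<le> c"
  shows "norm f \<le> c \<longleftrightarrow> (\<forall>\<phi>s. admissible \<phi>s \<longrightarrow> (\<Sum>\<phi>\<leftarrow>\<phi>s. \<bar>H0_apply f \<phi>\<bar>) \<le> c)"
proof -
  have "FBL_norm (H0_apply f) < \<infinity>" using H0_apply[of f] by simp
  then have "FBL_norm (H0_apply f) = ennreal (norm f)"
    unfolding norm_H0.rep_eq by simp
  then show ?thesis
    using FBL_norm_le_iff[OF assms, of "H0_apply f"] assms
    by simp
qed

lemma norm_H0_nonneg: "0 \<le> norm (f :: 'a H0)"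
  unfolding norm_H0.rep_eq by simp

lemma sum_list_le_norm_H0: "admissible \<phi>s \<Longrightarrow> (\<Sum>\<phi>\<leftarrow>\<phi>s. \<bar>H0_apply f \<phi>\<bar>) \<le> norm f"
  using norm_H0_le_iff[OF norm_H0_nonneg] by blast

lemma H0_apply_0_right: "H0_apply f 0 = 0"
proof -
  have "pos_homogeneous (H0_apply f)"
    using H0_apply[of f] by simp
  from this[unfolded pos_homogeneous_def, rule_format, of 2 0] show ?thesis by simp
qed

lemma abs_H0_apply_le: "\<bar>H0_apply f \<phi>\<bar> \<le> norm f * norm \<phi>"
proof (cases "\<phi> = 0")
  case True
  then show ?thesis by (simp add: H0_apply_0_right)
next
  case False
  define \<psi> where "\<psi> = (1 / norm \<phi>) *\<^sub>R \<phi>"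
  have "admissible [\<psi>]"
    unfolding admissible_def
  proof (intro ballI)
    fix x :: 'a assume "x \<in> cball 0 1"
    then have "\<bar>blinfun_apply \<phi> x\<bar> \<le> norm \<phi>"
      using norm_blinfun[of \<phi> x] mult_left_mono[of "norm x" 1 "norm \<phi>"] by simp
    then show "(\<Sum>\<phi>\<leftarrow>[\<psi>]. \<bar>blinfun_apply \<phi> x\<bar>) \<le> 1"
      using False by (simp add: \<psi>_def blinfun.scaleR_left abs_mult field_simps)
  qed
  from sum_list_le_norm_H0[OF this, of f] have *: "\<bar>H0_apply f \<psi>\<bar> \<le> norm f" by simp
  have "\<phi> = norm \<phi> *\<^sub>R \<psi>" using False by (simp add: \<psi>_def)
  moreover have "H0_apply f (norm \<phi> *\<^sub>R \<psi>) = norm \<phi> * H0_apply f \<psi>"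
    using H0_apply[of f] False by (simp add: pos_homogeneous_def)
  ultimately have "H0_apply f \<phi> = norm \<phi> * H0_apply f \<psi>"
    by simp
  then show ?thesis
    using mult_right_mono[OF *, of "norm \<phi>"] by (simp add: abs_mult mult.commute)
qed

instance
proof
  fix f g :: "'a H0" and a :: real
  show "dist f g = norm (f - g)" "sgn f = f /\<^sub>R norm f"
    "uniformity = (INF e\<in>{0 <..}. principal {(x, y :: 'a H0). dist x y < e})"
    by (fact dist_H0_def sgn_H0_def uniformity_H0_def)+
  show "open U = (\<forall>x\<in>U. eventually (\<lambda>(x', y). x' = x \<longrightarrow> y \<in> U) uniformity)" for U :: "'a H0 set"
    by (fact open_H0_def)
  show "norm f = 0 \<longleftrightarrow> f = 0"
  proof
    assume "norm f = 0"
    then have "H0_apply f \<phi> = 0" for \<phi>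
      using abs_H0_apply_le[of f \<phi>] by simp
    then show "f = 0"
      by transfer auto
  next
    assume "f = 0"
    then have "norm f \<le> 0"
      by (subst norm_H0_le_iff) (auto simp: zero_H0.rep_eq)
    then show "norm f = 0" using norm_H0_nonneg[of f] by simp
  qed
  show "norm (f + g) \<le> norm f + norm g"
  proof (subst norm_H0_le_iff, simp add: norm_H0_nonneg, intro allI impI)
    fix \<phi>s :: "('a \<Rightarrow>\<^sub>L real) list" assume "admissible \<phi>s"
    have "(\<Sum>\<phi>\<leftarrow>\<phi>s. \<bar>H0_apply (f + g) \<phi>\<bar>) \<le> (\<Sum>\<phi>\<leftarrow>\<phi>s. \<bar>H0_apply f \<phi>\<bar> + \<bar>H0_apply g \<phi>\<bar>)"
      by (rule sum_list_mono) (auto simp: plus_H0.rep_eq)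
    also have "\<dots> \<le> norm f + norm g"
      using sum_list_le_norm_H0[OF \<open>admissible \<phi>s\<close>] by (simp add: sum_list_addf add_mono)
    finally show "(\<Sum>\<phi>\<leftarrow>\<phi>s. \<bar>H0_apply (f + g) \<phi>\<bar>) \<le> norm f + norm g" .
  qed
  have le: "norm (b *\<^sub>R h) \<le> \<bar>b\<bar> * norm h" for b and h :: "'a H0"
    by (subst norm_H0_le_iff)
       (simp_all add: norm_H0_nonneg scaleR_H0.rep_eq abs_mult sum_list_const_mult
         mult_left_mono sum_list_le_norm_H0)
  show "norm (a *\<^sub>R f) = \<bar>a\<bar> * norm f"
  proof (cases "a = 0")
    case True
    then show ?thesis using le[of a f] norm_H0_nonneg[of "a *\<^sub>R f"] by simp
  next
    case False
    have "norm f \<le> \<bar>1 / a\<bar> * norm (a *\<^sub>R f)"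
      using le[of "1 / a" "a *\<^sub>R f"] False by simp
    then have "\<bar>a\<bar> * norm f \<le> norm (a *\<^sub>R f)"
      using False by (simp add: field_simps)
    with le[of a f] show ?thesis by simp
  qed
qed

end

instance H0 :: (banach) banach_lattice
proof
  fix f g :: "'a H0" and a b :: real
  show "f \<le> g \<Longrightarrow> 0 \<le> a \<Longrightarrow> a *\<^sub>R f \<le> a *\<^sub>R g"
    by transfer (simp add: mult_left_mono)
  show "a \<le> b \<Longrightarrow> 0 \<le> f \<Longrightarrow> a *\<^sub>R f \<le> b *\<^sub>R f"
    by transfer (simp add: mult_right_mono)
  show "norm f \<le> norm g" if "\<bar>f\<bar> \<le> \<bar>g\<bar>"
  proof (subst norm_H0_le_iff, simp, intro allI impI)
    fix \<phi>s :: "('a \<Rightarrow>\<^sub>L real) list" assume "admissible \<phi>s"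
    have "(\<Sum>\<phi>\<leftarrow>\<phi>s. \<bar>H0_apply f \<phi>\<bar>) \<le> (\<Sum>\<phi>\<leftarrow>\<phi>s. \<bar>H0_apply g \<phi>\<bar>)"
      using that by (intro sum_list_mono) (simp add: less_eq_H0.rep_eq abs_H0.rep_eq)
    also have "\<dots> \<le> norm g"
      by (rule sum_list_le_norm_H0) fact
    finally show "(\<Sum>\<phi>\<leftarrow>\<phi>s. \<bar>H0_apply f \<phi>\<bar>) \<le> norm g" .
  qed
next
  fix X :: "nat \<Rightarrow> 'a H0" assume X: "Cauchy X"
  have "Cauchy (\<lambda>n. H0_apply (X n) \<phi>)" for \<phi>
  proof (rule metric_CauchyI)
    fix e :: real assume "0 < e"
    then have "0 < e / (norm \<phi> + 1)" by (simp add: add_nonneg_pos)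
    from metric_CauchyD[OF X this] obtain M
      where M: "\<And>m n. m \<ge> M \<Longrightarrow> n \<ge> M \<Longrightarrow> norm (X m - X n) < e / (norm \<phi> + 1)"
      by (auto simp: dist_norm)
    have "dist (H0_apply (X m) \<phi>) (H0_apply (X n) \<phi>) < e" if "m \<ge> M" "n \<ge> M" for m n
    proof -
      have "dist (H0_apply (X m) \<phi>) (H0_apply (X n) \<phi>) \<le> norm (X m - X n) * norm \<phi>"
        using abs_H0_apply_le[of "X m - X n" \<phi>] by (simp add: dist_real_def minus_H0.rep_eq)
      also have "\<dots> \<le> norm (X m - X n) * (norm \<phi> + 1)"
        by (intro mult_left_mono) auto
      also have "\<dots> < e"
        using M[OF that] by (simp add: pos_less_divide_eq add_nonneg_pos)
      finally show ?thesis .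
    qed
    then show "\<exists>M. \<forall>m\<ge>M. \<forall>n\<ge>M. dist (H0_apply (X m) \<phi>) (H0_apply (X n) \<phi>) < e" by blast
  qed
  then have "\<exists>l. (\<lambda>n. H0_apply (X n) \<phi>) \<longlonglongrightarrow> l" for \<phi>
    by (simp add: Cauchy_convergent_iff convergent_def)
  then obtain l where l: "\<And>\<phi>. (\<lambda>n. H0_apply (X n) \<phi>) \<longlonglongrightarrow> l \<phi>" by metis
  have approx: "(\<Sum>\<phi>\<leftarrow>\<phi>s. \<bar>H0_apply (X m) \<phi> - l \<phi>\<bar>) \<le> e"
    if M: "\<And>n. n \<ge> M \<Longrightarrow> norm (X m - X n) \<le> e" and "admissible \<phi>s" for M m e \<phi>s
  proof (rule LIMSEQ_le_const2)
    have lim: "(\<lambda>n. \<Sum>\<phi>\<leftarrow>ps. \<bar>H0_apply (X m) \<phi> - H0_apply (X n) \<phi>\<bar>)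
        \<longlonglongrightarrow> (\<Sum>\<phi>\<leftarrow>ps. \<bar>H0_apply (X m) \<phi> - l \<phi>\<bar>)" for ps
      by (induction ps) (auto intro!: tendsto_intros l)
    show "(\<lambda>n. \<Sum>\<phi>\<leftarrow>\<phi>s. \<bar>H0_apply (X m) \<phi> - H0_apply (X n) \<phi>\<bar>)
        \<longlonglongrightarrow> (\<Sum>\<phi>\<leftarrow>\<phi>s. \<bar>H0_apply (X m) \<phi> - l \<phi>\<bar>)" by (rule lim)
    show "\<exists>N. \<forall>n\<ge>N. (\<Sum>\<phi>\<leftarrow>\<phi>s. \<bar>H0_apply (X m) \<phi> - H0_apply (X n) \<phi>\<bar>) \<le> e"
    proof (intro exI allI impI)
      fix n assume "n \<ge> M"
      from order_trans[OF sum_list_le_norm_H0[OF \<open>admissible \<phi>s\<close>] M[OF this]]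
      show "(\<Sum>\<phi>\<leftarrow>\<phi>s. \<bar>H0_apply (X m) \<phi> - H0_apply (X n) \<phi>\<bar>) \<le> e"
        by (simp add: minus_H0.rep_eq)
    qed
  qed
  have "pos_homogeneous l"
    unfolding pos_homogeneous_def
  proof (intro allI impI)
    fix c :: real and \<phi> assume "0 < c"
    then have "H0_apply (X n) (c *\<^sub>R \<phi>) = c * H0_apply (X n) \<phi>" for n
      using H0_apply[of "X n"] by (simp add: pos_homogeneous_def)
    then have "(\<lambda>n. c * H0_apply (X n) \<phi>) \<longlonglongrightarrow> l (c *\<^sub>R \<phi>)"
      using l[of "c *\<^sub>R \<phi>"] by simp
    moreover have "(\<lambda>n. c * H0_apply (X n) \<phi>) \<longlonglongrightarrow> c * l \<phi>"
      by (intro tendsto_intros l)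
    ultimately show "l (c *\<^sub>R \<phi>) = c * l \<phi>" by (rule LIMSEQ_unique)
  qed
  moreover have "FBL_norm l < \<infinity>"
  proof -
    obtain M where M: "\<And>m n. m \<ge> M \<Longrightarrow> n \<ge> M \<Longrightarrow> norm (X m - X n) < 1"
      using metric_CauchyD[OF X, of 1] by (auto simp: dist_norm)
    have "(\<Sum>\<phi>\<leftarrow>\<phi>s. \<bar>l \<phi>\<bar>) \<le> norm (X M) + 1" if "admissible \<phi>s" for \<phi>s
    proof -
      have "(\<Sum>\<phi>\<leftarrow>\<phi>s. \<bar>l \<phi>\<bar>) \<le> (\<Sum>\<phi>\<leftarrow>\<phi>s. \<bar>H0_apply (X M) \<phi>\<bar> + \<bar>H0_apply (X M) \<phi> - l \<phi>\<bar>)"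
        by (rule sum_list_mono) auto
      also have "\<dots> \<le> norm (X M) + 1"
        unfolding sum_list_addf
        using M by (intro add_mono sum_list_le_norm_H0 approx[of M] that) (auto intro: less_imp_le)
      finally show ?thesis .
    qed
    then show ?thesis unfolding FBL_norm_finite_iff by blast
  qed
  ultimately have "H0_apply (Abs_H0 l) = l"
    by (intro Abs_H0_inverse) simp
  then obtain L where L: "H0_apply L = l" ..
  have "X \<longlonglongrightarrow> L"
  proof (rule metric_LIMSEQ_I)
    fix e :: real assume "0 < e"
    then obtain M where M: "\<And>m n. m \<ge> M \<Longrightarrow> n \<ge> M \<Longrightarrow> norm (X m - X n) < e / 2"
      using metric_CauchyD[OF X, of "e / 2"] by (auto simp: dist_norm)
    have "norm (X m - L) \<le> e / 2" if "m \<ge> M" for m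
      using \<open>0 < e\<close> approx[of M m "e / 2"] M[OF that]
      by (subst norm_H0_le_iff) (auto simp: minus_H0.rep_eq L less_imp_le)
    then show "\<exists>M. \<forall>m\<ge>M. dist (X m) L < e"
      using \<open>0 < e\<close> by (intro exI[of _ M]) (force simp: dist_norm)
  qed
  then show "convergent X" by (auto simp: convergent_def)
qed


section \<open>The free Banach lattice over a Banach space\<close>

lift_definition delta_H0 :: "'a::banach \<Rightarrow> 'a H0" is "\<lambda>x \<phi>. blinfun_apply \<phi> x"
proof
  fix x :: 'a
  show "pos_homogeneous (\<lambda>\<phi>. blinfun_apply \<phi> x)"
    by (simp add: pos_homogeneous_def blinfun.scaleR_left)
  have "(\<Sum>\<phi>\<leftarrow>\<phi>s. \<bar>blinfun_apply \<phi> x\<bar>) \<le> norm x" if "admissible \<phi>s" for \<phi>s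
  proof (cases "x = 0")
    case False
    have "(\<Sum>\<phi>\<leftarrow>\<phi>s. \<bar>blinfun_apply \<phi> x\<bar>)
        = norm x * (\<Sum>\<phi>\<leftarrow>\<phi>s. \<bar>blinfun_apply \<phi> (x /\<^sub>R norm x)\<bar>)"
      using False by (simp add: blinfun.scaleR_right abs_mult sum_list_const_mult)
    also have "\<dots> \<le> norm x * 1"
      using that False unfolding admissible_def by (intro mult_left_mono) auto
    finally show ?thesis by simp
  qed (simp add: blinfun.zero_right)
  then show "FBL_norm (\<lambda>\<phi>. blinfun_apply \<phi> x) < \<infinity>"
    unfolding FBL_norm_finite_iff by blast
qed

text \<open>\<open>'a FBL\<close> is \<open>FBL[E]\<close> for the Banach space \<open>E = 'a\<close>; all of its structure, including the
  norm, is inherited from \<open>H\<^sub>0[E]\<close>.\<close>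

typedef (overloaded) 'a FBL = "generated_sublattice (range (delta_H0 :: 'a::banach \<Rightarrow> 'a H0))"
  morphisms H0_of_FBL Abs_FBL
  by (rule exI, rule subsetD[OF generated_sublattice_superset], rule rangeI)

setup_lifting type_definition_FBL

lemma FBL_carrier:
  fixes S :: "'a::banach H0 set"
  defines "S \<equiv> generated_sublattice (range delta_H0)"
  shows FBL_carrier_closed: "closed S"
    and FBL_carrier_subspace: "subspace S"
    and FBL_carrier_sup: "x \<in> S \<Longrightarrow> y \<in> S \<Longrightarrow> sup x y \<in> S"
    and FBL_carrier_inf: "x \<in> S \<Longrightarrow> y \<in> S \<Longrightarrow> inf x y \<in> S"
  using closed_sublattice_generated[of "range delta_H0 :: 'a H0 set"]
  unfolding S_def closed_sublattice_def by blast+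

instantiation FBL :: (banach) "{lattice_ab_group_add_abs, real_vector}"
begin

lift_definition zero_FBL :: "'a FBL" is 0
  by (rule subspace_0[OF FBL_carrier_subspace])

lift_definition plus_FBL :: "'a FBL \<Rightarrow> 'a FBL \<Rightarrow> 'a FBL" is "(+)"
  by (rule subspace_add[OF FBL_carrier_subspace])

lift_definition minus_FBL :: "'a FBL \<Rightarrow> 'a FBL \<Rightarrow> 'a FBL" is "(-)"
  by (rule subspace_diff[OF FBL_carrier_subspace])

lift_definition uminus_FBL :: "'a FBL \<Rightarrow> 'a FBL" is uminus
  by (rule subspace_neg[OF FBL_carrier_subspace])

lift_definition scaleR_FBL :: "real \<Rightarrow> 'a FBL \<Rightarrow> 'a FBL" is scaleR
  by (rule subspace_scale[OF FBL_carrier_subspace])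

lift_definition sup_FBL :: "'a FBL \<Rightarrow> 'a FBL \<Rightarrow> 'a FBL" is sup
  by (rule FBL_carrier_sup)

lift_definition inf_FBL :: "'a FBL \<Rightarrow> 'a FBL \<Rightarrow> 'a FBL" is inf
  by (rule FBL_carrier_inf)

lift_definition abs_FBL :: "'a FBL \<Rightarrow> 'a FBL" is abs
  unfolding abs_lattice by (intro FBL_carrier_sup subspace_neg[OF FBL_carrier_subspace])

lift_definition less_eq_FBL :: "'a FBL \<Rightarrow> 'a FBL \<Rightarrow> bool" is "(\<le>)" .

lift_definition less_FBL :: "'a FBL \<Rightarrow> 'a FBL \<Rightarrow> bool" is "(<)" .

instance
proof
  fix f g h :: "'a FBL" and a b :: real
  show "f + g + h = f + (g + h)" "f + g = g + f" "0 + f = f" "- f + f = 0" "f - g = f + - g"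
    by (simp_all add: H0_of_FBL_inject[symmetric] zero_FBL.rep_eq plus_FBL.rep_eq
        minus_FBL.rep_eq uminus_FBL.rep_eq scaleR_FBL.rep_eq algebra_simps)
  show "a *\<^sub>R (f + g) = a *\<^sub>R f + a *\<^sub>R g" "(a + b) *\<^sub>R f = a *\<^sub>R f + b *\<^sub>R f"
    "a *\<^sub>R b *\<^sub>R f = (a * b) *\<^sub>R f" "1 *\<^sub>R f = f"
    by (simp_all add: H0_of_FBL_inject[symmetric] zero_FBL.rep_eq plus_FBL.rep_eq
        minus_FBL.rep_eq uminus_FBL.rep_eq scaleR_FBL.rep_eq algebra_simps)
  show "f < g \<longleftrightarrow> f \<le> g \<and> \<not> g \<le> f"
    by (simp add: less_FBL.rep_eq less_eq_FBL.rep_eq less_le_not_le[where 'a = "'a H0"])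
  show "f \<le> f" by transfer simp
  show "f \<le> g \<Longrightarrow> g \<le> h \<Longrightarrow> f \<le> h" by transfer (rule order_trans)
  show "f \<le> g \<Longrightarrow> g \<le> f \<Longrightarrow> f = g" by transfer (rule antisym)
  show "f \<le> g \<Longrightarrow> h + f \<le> h + g" by transfer simp
  show "inf f g \<le> f" "inf f g \<le> g" "f \<le> sup f g" "g \<le> sup f g"
    by (simp_all add: less_eq_FBL.rep_eq inf_FBL.rep_eq sup_FBL.rep_eq)
  show "f \<le> g \<Longrightarrow> f \<le> h \<Longrightarrow> f \<le> inf g h" "g \<le> f \<Longrightarrow> h \<le> f \<Longrightarrow> sup g h \<le> f"
    by (simp_all add: less_eq_FBL.rep_eq inf_FBL.rep_eq sup_FBL.rep_eq)
  show "\<bar>f\<bar> = sup f (- f)" by transfer (rule abs_lattice)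
qed

end

instantiation FBL :: (banach) real_normed_vector
begin

lift_definition norm_FBL :: "'a FBL \<Rightarrow> real" is norm .

definition sgn_FBL :: "'a FBL \<Rightarrow> 'a FBL" where
  "sgn_FBL f = f /\<^sub>R norm f"

definition dist_FBL :: "'a FBL \<Rightarrow> 'a FBL \<Rightarrow> real" where
  "dist_FBL f g = norm (f - g)"

definition uniformity_FBL :: "('a FBL \<times> 'a FBL) filter" where
  "uniformity_FBL = (INF e\<in>{0 <..}. principal {(x, y). dist x y < e})"

definition open_FBL :: "'a FBL set \<Rightarrow> bool" where
  "open_FBL U = (\<forall>x\<in>U. eventually (\<lambda>(x', y). x' = x \<longrightarrow> y \<in> U) uniformity)"

instance
proof
  fix f g :: "'a FBL" and a :: real
  show "dist f g = norm (f - g)" "sgn f = f /\<^sub>R norm f"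
    "uniformity = (INF e\<in>{0 <..}. principal {(x, y :: 'a FBL). dist x y < e})"
    by (fact dist_FBL_def sgn_FBL_def uniformity_FBL_def)+
  show "open U = (\<forall>x\<in>U. eventually (\<lambda>(x', y). x' = x \<longrightarrow> y \<in> U) uniformity)" for U :: "'a FBL set"
    by (fact open_FBL_def)
  show "norm f = 0 \<longleftrightarrow> f = 0" by transfer simp
  show "norm (f + g) \<le> norm f + norm g" by transfer (rule norm_triangle_ineq)
  show "norm (a *\<^sub>R f) = \<bar>a\<bar> * norm f" by transfer simp
qed

end

lemma dist_H0_of_FBL: "dist (H0_of_FBL f) (H0_of_FBL g) = dist f g"
  by (simp add: dist_norm norm_FBL.rep_eq minus_FBL.rep_eq)

instance FBL :: (banach) banach_lattice
proof
  fix f g :: "'a FBL" and a b :: real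
  show "f \<le> g \<Longrightarrow> 0 \<le> a \<Longrightarrow> a *\<^sub>R f \<le> a *\<^sub>R g"
    by transfer (rule scaleR_left_mono)
  show "a \<le> b \<Longrightarrow> 0 \<le> f \<Longrightarrow> a *\<^sub>R f \<le> b *\<^sub>R f"
    by transfer (rule scaleR_right_mono)
  show "\<bar>f\<bar> \<le> \<bar>g\<bar> \<Longrightarrow> norm f \<le> norm g"
    by transfer (rule norm_abs_mono)
next
  fix X :: "nat \<Rightarrow> 'a FBL" assume "Cauchy X"
  then have "Cauchy (\<lambda>n. H0_of_FBL (X n))"
    by (simp add: Cauchy_def dist_H0_of_FBL)
  then obtain L where L: "(\<lambda>n. H0_of_FBL (X n)) \<longlonglongrightarrow> L"
    by (auto simp: Cauchy_convergent_iff convergent_def)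
  have "L \<in> generated_sublattice (range delta_H0)"
    using closed_sequentially[OF FBL_carrier_closed _ L] H0_of_FBL by blast
  then have "H0_of_FBL (Abs_FBL L) = L"
    by (rule Abs_FBL_inverse)
  then obtain F where "H0_of_FBL F = L" ..
  then have "X \<longlonglongrightarrow> F"
    using L by (auto simp: lim_sequentially dist_H0_of_FBL)
  then show "convergent X" by (auto simp: convergent_def)
qed

lift_definition delta :: "'a::banach \<Rightarrow> 'a FBL" is delta_H0
  by (rule subsetD[OF generated_sublattice_superset]) (rule rangeI)

text \<open>The definite description is well defined by the universal property of \<open>FBL[X]\<close>, applied to the
  identity of \<open>X\<close>; that property is not proved here.\<close>

definition beta :: "'a::banach_lattice FBL \<Rightarrow> 'a" where
  "beta = (THE b. lattice_hom b \<and> b \<circ> delta = id)"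

definition lattice_lifting_property :: "'a::banach_lattice itself \<Rightarrow> bool" where
  "lattice_lifting_property _ \<longleftrightarrow> (\<exists>T :: 'a \<Rightarrow> 'a FBL. lattice_hom T \<and> beta \<circ> T = id)"

end

theory Submission
  imports Defs "HOL-Library.Ramsey"
begin

text \<open>If \<open>\<beta> \<circ> T = id\<close> then \<open>T\<close> is injective, and both properties pass from \<open>FBL[X]\<close> to \<open>X\<close> along an
  injective lattice homomorphism; nothing else about \<open>\<beta>\<close> matters. Evaluations at functionals are
  lattice homomorphisms, which gives the first property for \<open>FBL[X]\<close>.

  For the chain condition, elements of \<open>FBL[E]\<close> are weak* continuous on bounded sets of functionals.
  So if \<open>f \<ge> 0\<close> is nonzero there are \<open>x\<close> in the dual ball and a finite tuple \<open>Z\<close> such that \<open>f\<close> is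
  positive at each \<open>y\<close> of norm at most 3 that is close to \<open>x\<close> on \<open>Z\<close>; bounding the size of \<open>Z\<close>
  splits the positive cone into countably many classes. Given many elements \<open>f\<^sub>i\<close> of one class,
  Ramsey's theorem yields \<open>i < q < k\<close> such that \<open>x\<^sub>k\<close> and \<open>x\<^sub>q\<close> nearly agree on \<open>Z\<^sub>i\<close> while \<open>x\<^sub>i\<close> and
  \<open>x\<^sub>q\<close> nearly agree on \<open>Z\<^sub>k\<close>. Then \<open>y = x\<^sub>i + x\<^sub>k - x\<^sub>q\<close> is close to \<open>x\<^sub>i\<close> on \<open>Z\<^sub>i\<close> and to \<open>x\<^sub>k\<close> on
  \<open>Z\<^sub>k\<close>, so \<open>f\<^sub>i\<close> and \<open>f\<^sub>k\<close> are both positive at \<open>y\<close>.\<close>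

section \<open>Combinatorial preliminaries\<close>

text \<open>Ramsey's theorem for triangles with \<open>card C\<close> colours. Only pairs with
  \<open>i < k\<close> are coloured, so \<open>c\<close> may be asymmetric.\<close>

lemma ramsey_ordered_triangle:
  assumes "finite C"
  shows "\<exists>N::nat. \<forall>c. (\<forall>i k. i < k \<longrightarrow> k < N \<longrightarrow> c i k \<in> C) \<longrightarrow>
    (\<exists>i q k. i < q \<and> q < k \<and> k < N \<and> c i k = c q k \<and> c i k = c i q)"
proof -
  obtain h :: "'a \<Rightarrow> nat" where h: "bij_betw h C {0..<card C}"
    using ex_bij_betw_finite_nat[OF assms] by blast
  obtain N :: nat where N: "partn_lst {..<N} (replicate (card C) 3) 2"
    using ramsey_full by blast
  have "\<exists>i q k. i < q \<and> q < k \<and> k < N \<and> c i k = c q k \<and> c i k = c i q"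
    if c: "\<And>i k. i < k \<Longrightarrow> k < N \<Longrightarrow> c i k \<in> C" for c
  proof -
    \<comment> \<open>\<open>Min\<close> and \<open>Max\<close> turn the colouring of ordered pairs
      into one of two-element sets, with colours numbered by \<open>h\<close>.\<close>
    define f where "f X = h (c (Min X) (Max X))" for X
    have f: "f {i, k} = h (c i k)" if "i < k" for i k
      using that by (simp add: f_def min_def max_def)
    have "f \<in> nsets {..<N} 2 \<rightarrow> {..<card C}"
      using c f bij_betwE[OF h] by (auto simp: ordered_nsets_2_eq)
    then obtain t Y where Y: "Y \<in> nsets {..<N} 3" and t: "f ` nsets Y 2 \<subseteq> {t}"
      using N unfolding partn_lst_def monochromatic_def by fastforce
    from Y obtain i q k where ord: "i < q" "q < k" "k < N" and "Y = {i, q, k}"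
      by (auto simp: ordered_nsets_3_eq)
    with t have "h (c i k) = t" "h (c q k) = t" "h (c i q) = t"
      using f[of i k] f[of q k] f[of i q] by (auto simp: image_subset_iff)
    moreover have "c i k \<in> C" "c q k \<in> C" "c i q \<in> C"
      using c ord by auto
    ultimately have "c i k = c q k" "c i k = c i q"
      using bij_betw_imp_inj_on[OF h] by (auto dest: inj_onD)
    with ord show ?thesis by blast
  qed
  then show ?thesis by blast
qed

text \<open>The definition ties the bound of a class to its index. Classes with arbitrary bounds are
  moved to large enough indices, at most one class per index, and the remaining indices get the
  empty set.\<close>

lemma sigma_bounded_chain_conditionI:
  fixes C :: "nat \<Rightarrow> 'a::banach_lattice set"
  assumes cover: "{x. 0 \<le> x} - {0} = (\<Union>m. C m)"
    and bounded: "\<And>m. \<exists>N. \<forall>G\<subseteq>C m. finite G \<longrightarrow> N \<le> card G \<longrightarrow> (\<exists>x\<in>G. \<exists>y\<in>G. x \<noteq> y \<and> inf x y \<noteq> 0)"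
  shows "sigma_bounded_chain_condition TYPE('a)"
proof -
  obtain N where N: "\<And>m G. G \<subseteq> C m \<Longrightarrow> finite G \<Longrightarrow> N m \<le> card G \<Longrightarrow>
      \<exists>x\<in>G. \<exists>y\<in>G. x \<noteq> y \<and> inf x y \<noteq> 0"
    using bounded by metis
  define s where "s m = 2 + m + (\<Sum>j\<le>m. N j)" for m
  have "strict_mono s"
    by (rule strict_monoI_Suc) (simp add: s_def)
  have s_ge: "2 \<le> s m" "N m \<le> s m" for m
    using member_le_sum[of m "{..m}" N] by (auto simp: s_def)
  define F where "F n = (\<Union>m\<in>{m. s m = n}. C m)" for n
  have "(\<Union>n\<in>{2..}. F n) = (\<Union>m. C m)"
    using s_ge(1) by (auto simp: F_def)
  moreover have "\<exists>x\<in>G. \<exists>y\<in>G. x \<noteq> y \<and> inf x y \<noteq> 0"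
    if n: "2 \<le> n" "G \<subseteq> F n" "card G = n" for n G
  proof -
    have "G \<noteq> {}" using n by auto
    then obtain m where "s m = n" using n by (auto simp: F_def)
    then have "F n = C m"
      using strict_mono_eq[OF \<open>strict_mono s\<close>] by (auto simp: F_def)
    \<comment> \<open>\<open>card\<close> is 0 on infinite sets, whereas \<open>n\<close> is at
      least 2.\<close>
    moreover have "finite G" using n card.infinite by fastforce
    ultimately show ?thesis
      using n \<open>s m = n\<close> s_ge(2)[of m] by (intro N) auto
  qed
  ultimately show ?thesis
    unfolding sigma_bounded_chain_condition_def cover by metis
qed

section \<open>Transfer along injective lattice homomorphisms\<close>

lemma lattice_hom_zero: "lattice_hom T \<Longrightarrow> T 0 = 0"
  by (simp add: lattice_hom_def linear_simps)

lemma lattice_hom_nonneg: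
  assumes "lattice_hom T" "0 \<le> x"
  shows "0 \<le> T x"
proof -
  have "T x = sup (T x) (T 0)"
    using assms by (metis lattice_hom_def sup.absorb1)
  then show ?thesis
    using lattice_hom_zero[OF assms(1)] by (metis sup.cobounded2)
qed

lemma lattice_hom_compose:
  "lattice_hom S \<Longrightarrow> lattice_hom T \<Longrightarrow> lattice_hom (\<lambda>x. S (T x))"
  by (simp add: lattice_hom_def bounded_linear_compose)

lemma separates_points_injective_lattice_hom:
  fixes T :: "'a::banach_lattice \<Rightarrow> 'b::banach_lattice"
  assumes T: "lattice_hom T" "inj T" and sep: "separates_points (Hom_real :: ('b \<Rightarrow>\<^sub>L real) set)"
  shows "separates_points (Hom_real :: ('a \<Rightarrow>\<^sub>L real) set)"
  unfolding separates_points_def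
proof (intro allI impI)
  fix x y :: 'a assume "x \<noteq> y"
  then have "T x \<noteq> T y" using T by (simp add: inj_eq)
  then obtain \<psi> :: "'b \<Rightarrow>\<^sub>L real" where \<psi>: "\<psi> \<in> Hom_real" "\<psi> (T x) \<noteq> \<psi> (T y)"
    using sep unfolding separates_points_def by blast
  have hom: "lattice_hom (\<lambda>x. \<psi> (T x))"
    using \<psi>(1) T(1) by (auto simp: Hom_real_def intro: lattice_hom_compose)
  then have "blinfun_apply (Blinfun (\<lambda>x. \<psi> (T x))) = (\<lambda>x. \<psi> (T x))"
    by (simp add: lattice_hom_def bounded_linear_Blinfun_apply)
  with hom \<psi>(2) show "\<exists>\<phi>\<in>Hom_real. blinfun_apply \<phi> x \<noteq> blinfun_apply \<phi> y"
    by (intro bexI[of _ "Blinfun (\<lambda>x. \<psi> (T x))"]) (auto simp: Hom_real_def)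
qed

text \<open>Preimages of the classes work: injectivity preserves cardinalities and nonzero elements,
  and \<open>T (inf x y)\<close> nonzero forces \<open>inf x y\<close> nonzero.\<close>

lemma sigma_bounded_chain_condition_injective_lattice_hom:
  fixes T :: "'a::banach_lattice \<Rightarrow> 'b::banach_lattice"
  assumes T: "lattice_hom T" "inj T" and "sigma_bounded_chain_condition TYPE('b)"
  shows "sigma_bounded_chain_condition TYPE('a)"
proof -
  obtain F :: "nat \<Rightarrow> 'b set" where F: "{x. 0 \<le> x} - {0} = (\<Union>n\<in>{2..}. F n)"
    and chain: "\<And>n G. 2 \<le> n \<Longrightarrow> G \<subseteq> F n \<Longrightarrow> card G = n \<Longrightarrow> \<exists>x\<in>G. \<exists>y\<in>G. x \<noteq> y \<and> inf x y \<noteq> 0"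
    using assms(3) unfolding sigma_bounded_chain_condition_def by metis
  define F' where "F' n = {x. 0 \<le> x \<and> T x \<in> F n}" for n
  have "{x. 0 \<le> x} - {0} = (\<Union>n\<in>{2..}. F' n)"
  proof (rule set_eqI)
    fix x
    have "T x = 0 \<longleftrightarrow> x = 0"
      using T lattice_hom_zero by (metis injD)
    moreover have "0 \<le> x \<Longrightarrow> 0 \<le> T x" by (rule lattice_hom_nonneg[OF T(1)])
    ultimately show "x \<in> {x. 0 \<le> x} - {0} \<longleftrightarrow> x \<in> (\<Union>n\<in>{2..}. F' n)"
      using F by (auto simp: F'_def set_eq_iff)
  qed
  moreover have "\<exists>x\<in>G. \<exists>y\<in>G. x \<noteq> y \<and> inf x y \<noteq> 0"
    if n: "2 \<le> n" "G \<subseteq> F' n" "card G = n" for n G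
  proof -
    have "card (T ` G) = n" "T ` G \<subseteq> F n"
      using n T by (auto simp: card_image inj_on_subset F'_def)
    from chain[OF n(1) this(2,1)] obtain x y where "x \<in> G" "y \<in> G" "T x \<noteq> T y" "inf (T x) (T y) \<noteq> 0"
      by blast
    moreover from this have "inf x y \<noteq> 0" "x \<noteq> y"
      using T(1) lattice_hom_zero[OF T(1)] by (metis lattice_hom_def, metis)
    ultimately show ?thesis by blast
  qed
  ultimately show ?thesis
    unfolding sigma_bounded_chain_condition_def by metis
qed

section \<open>Evaluation at functionals\<close>

definition eval_FBL :: "('a::banach \<Rightarrow>\<^sub>L real) \<Rightarrow> 'a FBL \<Rightarrow> real" where
  "eval_FBL \<phi> f = H0_apply (H0_of_FBL f) \<phi>"

lemma lattice_hom_eval_FBL: "lattice_hom (eval_FBL \<phi>)"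
  unfolding lattice_hom_def eval_FBL_def
proof (intro conjI allI)
  show "bounded_linear (\<lambda>f. H0_apply (H0_of_FBL f) \<phi>)"
    using abs_H0_apply_le[of _ \<phi>]
    by (intro bounded_linear_intro[of _ "norm \<phi>"])
       (auto simp: plus_FBL.rep_eq plus_H0.rep_eq scaleR_FBL.rep_eq scaleR_H0.rep_eq norm_FBL.rep_eq)
qed (simp_all add: sup_FBL.rep_eq sup_H0.rep_eq inf_FBL.rep_eq inf_H0.rep_eq)

lemma FBL_eqI: "(\<And>\<phi>. eval_FBL \<phi> f = eval_FBL \<phi> g) \<Longrightarrow> f = g"
  by (metis H0_apply_inject H0_of_FBL_inject eval_FBL_def ext)

lemma separates_points_FBL: "separates_points (Hom_real :: ('a::banach FBL \<Rightarrow>\<^sub>L real) set)"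
  unfolding separates_points_def
proof (intro allI impI)
  fix f g :: "'a FBL" assume "f \<noteq> g"
  then obtain \<phi> where \<phi>: "eval_FBL \<phi> f \<noteq> eval_FBL \<phi> g" using FBL_eqI by blast
  have "blinfun_apply (Blinfun (eval_FBL \<phi>)) = eval_FBL \<phi>"
    using lattice_hom_eval_FBL[of \<phi>] by (simp add: lattice_hom_def bounded_linear_Blinfun_apply)
  with \<phi> show "\<exists>\<psi>\<in>Hom_real. blinfun_apply \<psi> f \<noteq> blinfun_apply \<psi> g"
    using lattice_hom_eval_FBL[of \<phi>]
    by (intro bexI[of _ "Blinfun (eval_FBL \<phi>)"]) (auto simp: Hom_real_def)
qed

section \<open>Weak* continuity on bounded sets\<close>

text \<open>The weak* topology is the one that functionals inherit from the product topology on the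
  function type.\<close>

definition weak_star_continuous_on :: "('a::banach \<Rightarrow>\<^sub>L real) set \<Rightarrow> (('a \<Rightarrow>\<^sub>L real) \<Rightarrow> real) \<Rightarrow> bool" where
  "weak_star_continuous_on S f \<longleftrightarrow> continuous_on (blinfun_apply ` S) (\<lambda>g. f (Blinfun g))"

lemma weak_star_continuous_on_uniform_limit:
  assumes "\<And>n. weak_star_continuous_on S (f n)" "uniform_limit S f l sequentially"
  shows "weak_star_continuous_on S l"
  unfolding weak_star_continuous_on_def
proof (rule uniform_limit_theorem[OF _ _ sequentially_bot])
  show "\<forall>\<^sub>F n in sequentially. continuous_on (blinfun_apply ` S) (\<lambda>g. f n (Blinfun g))"
    using assms(1) by (simp add: weak_star_continuous_on_def)
  show "uniform_limit (blinfun_apply ` S) (\<lambda>n g. f n (Blinfun g)) (\<lambda>g. l (Blinfun g)) sequentially"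
    using assms(2) by (simp add: uniform_limit_iff blinfun_apply_inverse)
qed

text \<open>By \<open>abs_H0_apply_le\<close>, norm convergence is uniform on each ball, and uniform
  limits of continuous functions are continuous.\<close>

lemma closed_sublattice_weak_star_continuous:
  "closed_sublattice {f :: 'a::banach H0. weak_star_continuous_on (cball 0 R) (H0_apply f)}"
    (is "closed_sublattice ?S")
  unfolding closed_sublattice_def
proof (intro conjI ballI)
  show "closed ?S"
    unfolding closed_sequential_limits
  proof (intro allI impI, elim conjE)
    fix f :: "nat \<Rightarrow> 'a H0" and l
    assume f: "\<forall>n. f n \<in> ?S" and lim: "f \<longlonglongrightarrow> l"
    have "uniform_limit (cball 0 R) (\<lambda>n. H0_apply (f n)) (H0_apply l) sequentially"
    proof (rule uniform_limitI)
      fix e :: real assume "0 < e"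
      then have "0 < e / (\<bar>R\<bar> + 1)" by (simp add: add_nonneg_pos)
      with lim have "\<forall>\<^sub>F n in sequentially. dist (f n) l < e / (\<bar>R\<bar> + 1)"
        by (rule tendstoD)
      then show "\<forall>\<^sub>F n in sequentially. \<forall>\<phi>\<in>cball 0 R. dist (H0_apply (f n) \<phi>) (H0_apply l \<phi>) < e"
      proof (rule eventually_mono, intro ballI)
        fix n and \<phi> :: "'a \<Rightarrow>\<^sub>L real"
        assume n: "dist (f n) l < e / (\<bar>R\<bar> + 1)" and \<phi>: "\<phi> \<in> cball 0 R"
        have "dist (H0_apply (f n) \<phi>) (H0_apply l \<phi>) \<le> norm (f n - l) * norm \<phi>"
          using abs_H0_apply_le[of "f n - l" \<phi>] by (simp add: dist_real_def minus_H0.rep_eq)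
        also have "\<dots> \<le> norm (f n - l) * (\<bar>R\<bar> + 1)"
          using \<phi> by (intro mult_left_mono) auto
        also have "\<dots> < e"
          using n by (simp add: dist_norm pos_less_divide_eq add_nonneg_pos)
        finally show "dist (H0_apply (f n) \<phi>) (H0_apply l \<phi>) < e" .
      qed
    qed
    with f show "l \<in> ?S"
      by (auto intro: weak_star_continuous_on_uniform_limit)
  qed
  show "subspace ?S"
    by (auto simp: subspace_def weak_star_continuous_on_def zero_H0.rep_eq plus_H0.rep_eq
        scaleR_H0.rep_eq intro!: continuous_intros)
  show "sup f g \<in> ?S" "inf f g \<in> ?S" if "f \<in> ?S" "g \<in> ?S" for f g
    using that by (auto simp: weak_star_continuous_on_def sup_H0.rep_eq inf_H0.rep_eq
        sup_real_def inf_real_def intro!: continuous_intros)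
qed

text \<open>The generators are coordinate evaluations, so the closed sublattice of weak* continuous
  functions contains everything they generate.\<close>

lemma weak_star_continuous_on_eval_FBL:
  "weak_star_continuous_on (cball 0 R) (\<lambda>\<phi>. eval_FBL \<phi> (f :: 'a::banach FBL))"
proof -
  let ?S = "{f :: 'a H0. weak_star_continuous_on (cball 0 R) (H0_apply f)}"
  have "delta_H0 x \<in> ?S" for x :: 'a
  proof -
    have "continuous_on (blinfun_apply ` cball 0 R) (\<lambda>g. g x :: real)"
      by (rule continuous_on_subset[OF continuous_on_product_coordinates]) simp
    then have "continuous_on (blinfun_apply ` cball 0 R) (\<lambda>g. blinfun_apply (Blinfun g) x :: real)"
      by (rule continuous_on_eq) (auto simp: blinfun_apply_inverse)
    then show ?thesis
      by (simp add: weak_star_continuous_on_def delta_H0.rep_eq)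
  qed
  then have "generated_sublattice (range delta_H0) \<subseteq> ?S"
    unfolding generated_sublattice_def using closed_sublattice_weak_star_continuous by blast
  with H0_of_FBL[of f] show ?thesis
    by (auto simp: eval_FBL_def)
qed

text \<open>A basic open set of the product topology restricts finitely many coordinates. Dividing
  each coordinate vector by its tolerance lets a list of vectors with common tolerance 1 describe a
  box inside it.\<close>

lemma weak_star_continuous_on_pos_nhd:
  assumes cont: "weak_star_continuous_on S f" and x: "x \<in> S" "0 < f x"
  obtains Z :: "'a::banach list"
  where "\<And>y. y \<in> S \<Longrightarrow> \<forall>z\<in>set Z. \<bar>blinfun_apply y z - blinfun_apply x z\<bar> < 1 \<Longrightarrow> 0 < f y"
proof -
  from cont obtain U where U: "open U"
    "U \<inter> blinfun_apply ` S = (\<lambda>g. f (Blinfun g)) -` {0<..} \<inter> blinfun_apply ` S"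
    unfolding weak_star_continuous_on_def continuous_on_open_invariant by (meson open_greaterThan)
  have "blinfun_apply x \<in> U"
    using U(2) x by (auto simp: set_eq_iff blinfun_apply_inverse)
  then obtain X where X: "blinfun_apply x \<in> Pi\<^sub>E UNIV X" "\<And>i. open (X i)"
    "finite {i. X i \<noteq> UNIV}" "Pi\<^sub>E UNIV X \<subseteq> U"
    using product_topology_open_contains_basis[of "\<lambda>_. euclidean" UNIV U] U(1)
    unfolding open_fun_def topspace_euclidean open_openin[symmetric] by metis
  define J where "J = {i. X i \<noteq> UNIV}"
  have "\<exists>e>0. \<forall>t. \<bar>t - blinfun_apply x i\<bar> < e \<longrightarrow> t \<in> X i" for i
  proof -
    have "blinfun_apply x i \<in> X i" using X(1) by auto
    then show ?thesis
      using X(2)[of i] unfolding open_dist dist_real_def by blast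
  qed
  then obtain e where e: "\<And>i. 0 < e i" "\<And>i t. \<bar>t - blinfun_apply x i\<bar> < e i \<Longrightarrow> t \<in> X i"
    by metis
  obtain Z where Z: "set Z = (\<lambda>i. i /\<^sub>R e i) ` J"
    using finite_list[of "(\<lambda>i. i /\<^sub>R e i) ` J"] X(3) by (auto simp: J_def)
  show thesis
  proof (rule that[of Z])
    fix y assume y: "y \<in> S" "\<forall>z\<in>set Z. \<bar>blinfun_apply y z - blinfun_apply x z\<bar> < 1"
    have "blinfun_apply y i \<in> X i" for i
    proof (cases "i \<in> J")
      case True
      with y(2) Z have "\<bar>blinfun_apply y (i /\<^sub>R e i) - blinfun_apply x (i /\<^sub>R e i)\<bar> < 1"
        by blast
      then have "\<bar>(blinfun_apply y i - blinfun_apply x i) / e i\<bar> < 1"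
        by (simp add: blinfun.scaleR_right divide_inverse algebra_simps)
      then show ?thesis
        using e(1)[of i] by (intro e(2)) (simp add: abs_divide)
    qed (simp add: J_def)
    then have "blinfun_apply y \<in> U" using X(4) by auto
    then have "blinfun_apply y \<in> (\<lambda>g. f (Blinfun g)) -` {0<..}"
      using y(1) U(2) by blast
    then show "0 < f y" by (simp add: blinfun_apply_inverse)
  qed
qed

section \<open>The countable cover of the positive cone\<close>

text \<open>Bounding the test vectors in number and norm by \<open>m\<close> leaves finitely many
  lists of rounded values. The radius 3 makes room for a signed sum of three functionals of norm at
  most 1.\<close>

definition FBL_chain_class :: "nat \<Rightarrow> 'a::banach FBL set" where
  "FBL_chain_class m = {f. 0 \<le> f \<and> (\<exists>x Z. norm x \<le> 1 \<and> length Z \<le> m \<and> (\<forall>z\<in>set Z. norm z \<le> m) \<and>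
     (\<forall>y. norm y \<le> 3 \<longrightarrow> (\<forall>z\<in>set Z. \<bar>blinfun_apply y z - blinfun_apply x z\<bar> < 1) \<longrightarrow> 0 < eval_FBL y f))}"

lemma FBL_chain_class_cover: "{f. 0 \<le> f} - {0} = (\<Union>m. FBL_chain_class m :: 'a::banach FBL set)"
proof (intro equalityI subsetI)
  fix f :: "'a FBL" assume f: "f \<in> {f. 0 \<le> f} - {0}"
  obtain w where "eval_FBL w f \<noteq> eval_FBL w 0"
    using f FBL_eqI by blast
  then have w: "0 < eval_FBL w f"
    using lattice_hom_nonneg[OF lattice_hom_eval_FBL, of f w] lattice_hom_zero[OF lattice_hom_eval_FBL] f
    by (metis DiffD1 less_le mem_Collect_eq)
  then have "0 < norm w"
    by (auto simp: eval_FBL_def H0_apply_0_right)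
  \<comment> \<open>Positive homogeneity keeps the value positive under normalisation.\<close>
  define x where "x = w /\<^sub>R norm w"
  have "pos_homogeneous (H0_apply (H0_of_FBL f))"
    using H0_apply[of "H0_of_FBL f"] by simp
  then have x: "0 < eval_FBL x f" "norm x = 1"
    using w \<open>0 < norm w\<close> by (auto simp: x_def eval_FBL_def pos_homogeneous_def)
  obtain Z where Z: "\<And>y. y \<in> cball 0 3 \<Longrightarrow>
      \<forall>z\<in>set Z. \<bar>blinfun_apply y z - blinfun_apply x z\<bar> < 1 \<Longrightarrow> 0 < eval_FBL y f"
    using weak_star_continuous_on_pos_nhd[OF weak_star_continuous_on_eval_FBL, of x 3 f] x by auto
  \<comment> \<open>Inserting 0 keeps \<open>Max\<close> meaningful when \<open>Z\<close> is
    empty.\<close>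
  obtain m0 :: nat where m0: "Max (insert 0 (norm ` set Z)) \<le> m0"
    using real_arch_simple by blast
  define m where "m = max m0 (length Z)"
  have "norm z \<le> m" if "z \<in> set Z" for z
    using m0 that by (auto simp: m_def)
  then have "f \<in> FBL_chain_class m"
    unfolding FBL_chain_class_def using f x Z by (auto simp: m_def intro!: exI[of _ x] exI[of _ Z])
  then show "f \<in> (\<Union>m. FBL_chain_class m)" by blast
next
  fix f :: "'a FBL" assume "f \<in> (\<Union>m. FBL_chain_class m)"
  \<comment> \<open>The point \<open>x\<close> satisfies its own constraints, so \<open>f\<close> is
    positive there.\<close>
  then obtain x where "0 \<le> f" "norm x \<le> 1" "0 < eval_FBL x f"
    by (fastforce simp: FBL_chain_class_def)
  then show "f \<in> {f. 0 \<le> f} - {0}"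
    using lattice_hom_zero[OF lattice_hom_eval_FBL, of x] by auto
qed

lemma floor_eq_imp_abs_diff_less_1:
  "\<lfloor>a\<rfloor> = \<lfloor>b\<rfloor> \<Longrightarrow> \<bar>a - b\<bar> < (1::real)"
  by linarith

lemma FBL_chain_class_bounded:
  "\<exists>N. \<forall>G\<subseteq>FBL_chain_class m :: 'a::banach FBL set. finite G \<longrightarrow> N \<le> card G \<longrightarrow>
     (\<exists>f\<in>G. \<exists>g\<in>G. f \<noteq> g \<and> inf f g \<noteq> 0)"
proof -
  \<comment> \<open>\<open>L\<close> contains every list of integer parts that a functional of norm
    at most 1 can take on the test vectors of a class member.\<close>
  define L where "L = {xs :: int list. set xs \<subseteq> {- int m - 1..int m} \<and> length xs \<le> m}"
  have "finite L" unfolding L_def by (rule finite_lists_length_le) simp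
  then obtain N :: nat where N: "\<And>c. (\<And>i k. i < k \<Longrightarrow> k < N \<Longrightarrow> c i k \<in> L \<times> L) \<Longrightarrow>
      \<exists>i q k. i < q \<and> q < k \<and> k < N \<and> c i k = c q k \<and> c i k = c i q"
    using ramsey_ordered_triangle[of "L \<times> L"] by (metis finite_cartesian_product)
  have "\<exists>f\<in>G. \<exists>g\<in>G. f \<noteq> g \<and> inf f g \<noteq> 0"
    if G: "G \<subseteq> FBL_chain_class m" "finite G" "N \<le> card G" for G :: "'a FBL set"
  proof -
    obtain h where h: "bij_betw h {0..<card G} G"
      using ex_bij_betw_nat_finite[OF G(2)] by blast
    have "h i \<in> FBL_chain_class m" if "i < N" for i
      using that G h by (auto dest!: bij_betwE)
    then obtain x Z where xZ: "\<And>i. i < N \<Longrightarrow> norm (x i) \<le> 1" "\<And>i. i < N \<Longrightarrow> length (Z i) \<le> m"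
      "\<And>i z. i < N \<Longrightarrow> z \<in> set (Z i) \<Longrightarrow> norm z \<le> m"
      and pos: "\<And>i y. i < N \<Longrightarrow> norm y \<le> 3 \<Longrightarrow>
        \<forall>z\<in>set (Z i). \<bar>blinfun_apply y z - blinfun_apply (x i) z\<bar> < 1 \<Longrightarrow> 0 < eval_FBL y (h i)"
      unfolding FBL_chain_class_def mem_Collect_eq by metis
    \<comment> \<open>\<open>c i k\<close> records \<open>x i\<close> on the test vectors
      \<open>Z k\<close> up to rounding; equal lists give differences below 1 there.\<close>
    define c where "c i k = map (\<lambda>z. \<lfloor>blinfun_apply (x i) z\<rfloor>) (Z k)" for i k
    have c_mem: "c i k \<in> L" if "i < N" "k < N" for i k
    proof -
      have "\<bar>blinfun_apply (x i) z\<bar> \<le> m" if "z \<in> set (Z k)" for z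
      proof -
        have "\<bar>blinfun_apply (x i) z\<bar> \<le> norm (x i) * norm z"
          using norm_blinfun[of "x i" z] by simp
        also have "\<dots> \<le> 1 * real m"
          using xZ(1)[OF \<open>i < N\<close>] xZ(3)[OF \<open>k < N\<close> that] by (intro mult_mono) auto
        finally show ?thesis by simp
      qed
      then have "\<lfloor>blinfun_apply (x i) z\<rfloor> \<in> {- int m - 1..int m}" if "z \<in> set (Z k)" for z
        using that by (fastforce simp: abs_le_iff le_floor_iff floor_le_iff)
      then show ?thesis
        using xZ(2)[OF \<open>k < N\<close>] by (auto simp: L_def c_def)
    qed
    have c_close: "\<bar>blinfun_apply (x i) z - blinfun_apply (x j) z\<bar> < 1"
      if "c i k = c j k" "z \<in> set (Z k)" for i j k z
      using that by (intro floor_eq_imp_abs_diff_less_1) (auto simp: c_def)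
    \<comment> \<open>Both directions enter the colour, so that values on \<open>Z k\<close> and on
      \<open>Z i\<close> are controlled at once.\<close>
    obtain i q k where ord: "i < q" "q < k" "k < N"
      and "(c i k, c k i) = (c q k, c k q)" "(c i k, c k i) = (c i q, c q i)"
      using N[of "\<lambda>i k. (c i k, c k i)"] c_mem by auto
    \<comment> \<open>The two pairs with common end \<open>k\<close> give the first equality, those
      with common start \<open>i\<close> the second.\<close>
    then have eq: "c i k = c q k" "c k i = c q i" by simp_all
    define y where "y = x i + x k - x q"
    have "norm y \<le> norm (x i) + norm (x k) + norm (x q)"
      unfolding y_def by (meson add_right_mono norm_triangle_ineq norm_triangle_ineq4 order_trans)
    then have y: "norm y \<le> 3"
      using xZ(1)[of i] xZ(1)[of k] xZ(1)[of q] ord by simp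
    have y_minus: "blinfun_apply y z - blinfun_apply (x i) z = blinfun_apply (x k) z - blinfun_apply (x q) z"
      "blinfun_apply y z - blinfun_apply (x k) z = blinfun_apply (x i) z - blinfun_apply (x q) z" for z
      by (simp_all add: y_def blinfun.add_left blinfun.diff_left)
    have "0 < eval_FBL y (h i)" "0 < eval_FBL y (h k)"
      using ord y c_close[OF eq(1)] c_close[OF eq(2)] by (auto intro!: pos simp: y_minus)
    \<comment> \<open>Evaluation at \<open>y\<close> turns the infimum into the minimum of two
      positive numbers.\<close>
    then have "eval_FBL y (inf (h i) (h k)) > 0"
      using lattice_hom_eval_FBL[of y] by (simp add: lattice_hom_def inf_real_def)
    then have "inf (h i) (h k) \<noteq> 0"
      using lattice_hom_zero[OF lattice_hom_eval_FBL, of y] by auto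
    moreover have "h i \<in> G" "h k \<in> G" "h i \<noteq> h k"
      using bij_betwE[OF h] inj_on_eq_iff[OF bij_betw_imp_inj_on[OF h], of i k] ord G(3) by auto
    ultimately show ?thesis by blast
  qed
  then show ?thesis by blast
qed

lemma sigma_bounded_chain_condition_FBL: "sigma_bounded_chain_condition TYPE('a::banach FBL)"
  by (rule sigma_bounded_chain_conditionI[OF FBL_chain_class_cover FBL_chain_class_bounded])

theorem corollary2p5:
  assumes "lattice_lifting_property TYPE('a::banach_lattice)"
  shows "separates_points (Hom_real :: ('a \<Rightarrow>\<^sub>L real) set) \<and>
    sigma_bounded_chain_condition TYPE('a)"
proof -
  obtain T :: "'a \<Rightarrow> 'a FBL" where T: "lattice_hom T" "beta \<circ> T = id"
    using assms unfolding lattice_lifting_property_def by blast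
  have "inj T"
    using T(2) by (metis inj_on_id inj_on_imageI2)
  with T(1) show ?thesis
    using separates_points_injective_lattice_hom[OF _ _ separates_points_FBL]
      sigma_bounded_chain_condition_injective_lattice_hom[OF _ _ sigma_bounded_chain_condition_FBL]
    by blast
qed

end
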